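(* If $\mathbf{M}$ is a Fraïssé limit (in a relational language) satisfying the free amalgamation property, then $\mathrm{Aut}(\mathbf{M})$ is dissociated.
   Context: A Fraïssé limit $\mathbf{M}$ in a relational language $\mathcal{L}$ is a countable (infinite) $\mathcal{L}$-structure which is ultrahomogeneous (every isomorphism between finite substructures extends to an automorphism); $\mathrm{Age}(\mathbf{M})$ is the class of finite structures embeddable in $\mathbf{M}$. $\mathbf{M}$ satisfies the free amalgamation property if for all $\mathbf{A},\mathbf{B}_1,\mathbf{B}_2\in\mathrm{Age}(\mathbf{M})$ and all embeddings $f_i:\mathbf{A}\to\mathbf{B}_i$ ($i=1,2$), there exist $\mathbf{C}\in\mathrm{Age}(\mathbf{M})$ and embeddings $g_i:\mathbf{B}_i\to\mathbf{C}$ such that: $g_1\circ f_1=g_2\circ f_2$; if $b_i\in\mathbf{B}_i$ satisfy $g_1(b_1)=g_2(b_2)$, then there is $a\in\mathbf{A}$ with $f_i(a)=b_i$ for $i=1,2$; and for every relation $R\in\mathcal{L}$ and every tuple $\overline{c}$ of elements of $\mathbf{C}$ such that $R^{\mathbf{C}}(\overline{c})$ holds, $\overline{c}$ is a tuple either of elements of $g_1(\mathbf{B}_1)$ or of elements of $g_2(\mathbf{B}_2)$. Let $\Omega=\mathrm{dom}(\mathbf{M})$. $G=\mathrm{Aut}(\mathbf{M})$ is a closed subgroup of $\mathrm{Sym}(\Omega)$ with the topology of pointwise convergence. For $A\subseteq\Omega$, $G_A$ is the pointwise stabilizer of $A$. A unitary representation of $G$ on a Hilbert space $\mathcal{H}$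 is a homomorphism $\pi:G\to\mathcal{U}(\mathcal{H})$ with $g\mapsto\pi(g)\xi$ continuous for all $\xi$. It is dissociated if $p_Ap_B=p_{A\cap B}$ for all finite $A,B\subseteq\Omega$, where $p_A$ is the orthogonal projection onto $\mathcal{H}_A=\{\xi\in\mathcal{H}:\pi(g)\xi=\xi\text{ for all }g\in G_A\}$. $G$ is dissociated if all of its unitary representations are dissociated. *)

theory Defs
  imports
    "HOL-Analysis.Analysis"
    "HOL-Combinatorics.Permutations"
    "HOL-Algebra.Group"
begin

section \<open>Relational structures\<close>

record 'r language =
  symbols :: "'r set"
  arity :: "'r \<Rightarrow> nat"

text \<open>Interpretations of names outside \<^term>\<open>symbols L\<close> are irrelevant everywhere below.\<close>

record ('a, 'r) rel_structure =
  universe :: "'a set"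
  rel :: "'r \<Rightarrow> 'a list set"

definition is_structure :: "'r language \<Rightarrow> ('a, 'r) rel_structure \<Rightarrow> bool" where
  "is_structure L M \<longleftrightarrow>
     (\<forall>R \<in> symbols L. \<forall>xs \<in> rel M R. length xs = arity L R \<and> set xs \<subseteq> universe M)"

definition embedding ::
    "'r language \<Rightarrow> ('a, 'r) rel_structure \<Rightarrow> ('b, 'r) rel_structure \<Rightarrow> ('a \<Rightarrow> 'b) \<Rightarrow> bool" where
  "embedding L A B f \<longleftrightarrow>
     inj_on f (universe A) \<and> f ` universe A \<subseteq> universe B \<and>
     (\<forall>R \<in> symbols L. \<forall>xs. length xs = arity L R \<and> set xs \<subseteq> universe A \<longrightarrow>
        (xs \<in> rel A R \<longleftrightarrow> map f xs \<in> rel B R))"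

definition isomorphism ::
    "'r language \<Rightarrow> ('a, 'r) rel_structure \<Rightarrow> ('b, 'r) rel_structure \<Rightarrow> ('a \<Rightarrow> 'b) \<Rightarrow> bool" where
  "isomorphism L A B f \<longleftrightarrow> embedding L A B f \<and> f ` universe A = universe B"

definition substructure :: "('a, 'r) rel_structure \<Rightarrow> 'a set \<Rightarrow> ('a, 'r) rel_structure" where
  "substructure M A = \<lparr>universe = A, rel = (\<lambda>R. {xs \<in> rel M R. set xs \<subseteq> A})\<rparr>"

text \<open>Permutations of the universe are represented by functions on the whole type that are the
  identity outside the universe.\<close>

definition Aut :: "'r language \<Rightarrow> ('a, 'r) rel_structure \<Rightarrow> ('a \<Rightarrow> 'a) monoid" where
  "Aut L M = \<lparr>carrier = {g. g permutes universe M \<and> isomorphism L M M g},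
              mult = (\<circ>), one = id\<rparr>"

definition ultrahomogeneous :: "'r language \<Rightarrow> ('a, 'r) rel_structure \<Rightarrow> bool" where
  "ultrahomogeneous L M \<longleftrightarrow>
     (\<forall>A B f. finite A \<and> A \<subseteq> universe M \<and> finite B \<and> B \<subseteq> universe M \<and>
        isomorphism L (substructure M A) (substructure M B) f \<longrightarrow>
        (\<exists>g \<in> carrier (Aut L M). \<forall>x \<in> A. g x = f x))"

definition fraisse_limit :: "'r language \<Rightarrow> ('a, 'r) rel_structure \<Rightarrow> bool" where
  "fraisse_limit L M \<longleftrightarrow>
     is_structure L M \<and> countable (universe M) \<and> infinite (universe M) \<and> ultrahomogeneous L M"

definition Age :: "'r language \<Rightarrow> ('a, 'r) rel_structure \<Rightarrow> ('b, 'r) rel_structure set" where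
  "Age L M = {A. is_structure L A \<and> finite (universe A) \<and> (\<exists>f. embedding L A M f)}"

text \<open>Every finite structure has an isomorphic copy whose universe is a set of natural numbers, so
  it suffices to let the members of the age range over such structures. The empty structure is
  among them.\<close>

definition free_amalgamation :: "'r language \<Rightarrow> ('a, 'r) rel_structure \<Rightarrow> bool" where
  "free_amalgamation L M \<longleftrightarrow>
     (\<forall>A \<in> Age L M. \<forall>B1 \<in> Age L M. \<forall>B2 \<in> Age L M. \<forall>f1 f2.
        embedding L (A :: (nat, 'r) rel_structure) (B1 :: (nat, 'r) rel_structure) f1 \<and>
        embedding L A (B2 :: (nat, 'r) rel_structure) f2 \<longrightarrow>
        (\<exists>C \<in> Age L M. \<exists>g1 g2.
           embedding L B1 (C :: (nat, 'r) rel_structure) g1 \<and> embedding L B2 C g2 \<and>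
           (\<forall>a \<in> universe A. g1 (f1 a) = g2 (f2 a)) \<and>
           (\<forall>b1 \<in> universe B1. \<forall>b2 \<in> universe B2. g1 b1 = g2 b2 \<longrightarrow>
              (\<exists>a \<in> universe A. f1 a = b1 \<and> f2 a = b2)) \<and>
           (\<forall>R \<in> symbols L. \<forall>c \<in> rel C R.
              set c \<subseteq> g1 ` universe B1 \<or> set c \<subseteq> g2 ` universe B2)))"


section \<open>Complex Hilbert spaces\<close>

text \<open>The inner product is linear in the first argument. The real normed structure of the
  superclass is the one underlying the complex inner product space.\<close>

class complex_inner = real_normed_vector +
  fixes scaleC :: "complex \<Rightarrow> 'a \<Rightarrow> 'a"
    and cinner :: "'a \<Rightarrow> 'a \<Rightarrow> complex"
  assumes scaleC_add_right: "scaleC c (x + y) = scaleC c x + scaleC c y"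
    and scaleC_add_left: "scaleC (c + d) x = scaleC c x + scaleC d x"
    and scaleC_scaleC: "scaleC c (scaleC d x) = scaleC (c * d) x"
    and scaleR_scaleC: "scaleR r x = scaleC (complex_of_real r) x"
    and cinner_commute: "cinner x y = cnj (cinner y x)"
    and cinner_add_left: "cinner (x + y) z = cinner x z + cinner y z"
    and cinner_scaleC_left: "cinner (scaleC c x) y = c * cinner x y"
    and cinner_self: "cinner x x = complex_of_real ((norm x)\<^sup>2)"

class complex_hilbert_space = complex_inner + complete_space

instantiation complex :: complex_hilbert_space
begin

definition "scaleC c x = c * (x :: complex)"
definition "cinner x y = x * cnj (y :: complex)"

instance
proof
  fix c d x y z :: complex and r :: real
  show "scaleC c (x + y) = scaleC c x + scaleC c y"
    by (simp add: scaleC_complex_def distrib_left)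
  show "scaleC (c + d) x = scaleC c x + scaleC d x"
    by (simp add: scaleC_complex_def distrib_right)
  show "scaleC c (scaleC d x) = scaleC (c * d) x"
    by (simp add: scaleC_complex_def)
  show "scaleR r x = scaleC (complex_of_real r) x"
    by (simp add: scaleC_complex_def scaleR_conv_of_real)
  show "cinner x y = cnj (cinner y x)"
    by (simp add: cinner_complex_def)
  show "cinner (x + y) z = cinner x z + cinner y z"
    by (simp add: cinner_complex_def distrib_right)
  show "cinner (scaleC c x) y = c * cinner x y"
    by (simp add: scaleC_complex_def cinner_complex_def)
  show "cinner x x = complex_of_real ((norm x)\<^sup>2)"
    by (simp only: cinner_complex_def complex_norm_square)
qed

end

lemma vector_space_scaleC: "vector_space (scaleC :: complex \<Rightarrow> 'h \<Rightarrow> 'h::complex_inner)"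
proof
  show "scaleC 1 x = x" for x :: 'h
    using scaleR_scaleC[of 1 x] by simp
qed (simp_all add: scaleC_add_right scaleC_add_left scaleC_scaleC)

text \<open>For a closed subspace \<open>S\<close> of a Hilbert space, the defining property has exactly one
  solution.\<close>

definition orth_proj :: "'h::complex_hilbert_space set \<Rightarrow> 'h \<Rightarrow> 'h" where
  "orth_proj S x = (THE y. y \<in> S \<and> (\<forall>z \<in> S. cinner (x - y) z = 0))"

definition unitary :: "('h::complex_hilbert_space \<Rightarrow> 'h) \<Rightarrow> bool" where
  "unitary U \<longleftrightarrow>
     Vector_Spaces.linear scaleC scaleC U \<and> (\<forall>x y. cinner (U x) (U y) = cinner x y) \<and> surj U"

definition unitary_group :: "('h::complex_hilbert_space \<Rightarrow> 'h) monoid" where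
  "unitary_group = \<lparr>carrier = {U. unitary U}, mult = (\<circ>), one = id\<rparr>"


section \<open>Unitary representations of permutation groups\<close>

definition pointwise_topology :: "('a \<Rightarrow> 'a) monoid \<Rightarrow> ('a \<Rightarrow> 'a) topology" where
  "pointwise_topology G =
     subtopology (product_topology (\<lambda>_. discrete_topology UNIV) UNIV) (carrier G)"

definition unitary_rep ::
    "('a \<Rightarrow> 'a) monoid \<Rightarrow> (('a \<Rightarrow> 'a) \<Rightarrow> 'h \<Rightarrow> 'h::complex_hilbert_space) \<Rightarrow> bool" where
  "unitary_rep G \<pi> \<longleftrightarrow>
     \<pi> \<in> hom G unitary_group \<and>
     (\<forall>\<xi>. continuous_map (pointwise_topology G) euclidean (\<lambda>g. \<pi> g \<xi>))"

definition pointwise_stabilizer :: "('a \<Rightarrow> 'a) monoid \<Rightarrow> 'a set \<Rightarrow> ('a \<Rightarrow> 'a) set" where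
  "pointwise_stabilizer G A = {g \<in> carrier G. \<forall>a \<in> A. g a = a}"

definition fixed_vectors ::
    "('a \<Rightarrow> 'a) monoid \<Rightarrow> (('a \<Rightarrow> 'a) \<Rightarrow> 'h \<Rightarrow> 'h::complex_hilbert_space) \<Rightarrow> 'a set \<Rightarrow> 'h set" where
  "fixed_vectors G \<pi> A = {\<xi>. \<forall>g \<in> pointwise_stabilizer G A. \<pi> g \<xi> = \<xi>}"

definition dissociated_rep ::
    "'a set \<Rightarrow> ('a \<Rightarrow> 'a) monoid \<Rightarrow> (('a \<Rightarrow> 'a) \<Rightarrow> 'h \<Rightarrow> 'h::complex_hilbert_space) \<Rightarrow> bool" where
  "dissociated_rep \<Omega> G \<pi> \<longleftrightarrow>
     (\<forall>A B. finite A \<and> A \<subseteq> \<Omega> \<and> finite B \<and> B \<subseteq> \<Omega> \<longrightarrow>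
        orth_proj (fixed_vectors G \<pi> A) \<circ> orth_proj (fixed_vectors G \<pi> B) =
        orth_proj (fixed_vectors G \<pi> (A \<inter> B)))"

text \<open>HOL cannot quantify over types inside a formula. Dissociation is therefore parametrised by the
  type of the Hilbert space; a theorem in which this type is arbitrary covers all Hilbert spaces.\<close>

definition dissociated ::
    "'h::complex_hilbert_space itself \<Rightarrow> 'a set \<Rightarrow> ('a \<Rightarrow> 'a) monoid \<Rightarrow> bool" where
  "dissociated _ \<Omega> G \<longleftrightarrow>
     (\<forall>\<pi> :: ('a \<Rightarrow> 'a) \<Rightarrow> 'h \<Rightarrow> 'h. unitary_rep G \<pi> \<longrightarrow> dissociated_rep \<Omega> G \<pi>)"

end

theory Submission
  imports Defs
begin

text \<open>
  Write \<open>H A\<close> for the vectors fixed by the pointwise stabilizer of a finite set \<open>A\<close>, and let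
  \<open>C = A \<inter> B\<close>. Since \<open>H C\<close> is contained in \<open>H A\<close> and in \<open>H B\<close>, dissociation amounts to the
  statement that for \<open>\<xi>\<close> in \<open>H A\<close> with projection \<open>z\<close> onto \<open>H C\<close>, the difference \<open>\<xi> - z\<close> is
  orthogonal to \<open>H B\<close> (\<open>fix_orthogonal\<close>).

  Free amalgamation together with ultrahomogeneity yields two combinatorial facts. Any finite set
  containing \<open>B\<close> can be moved over \<open>B\<close> so as to become free over \<open>B\<close> from any given finite set
  (\<open>free_copy_exists\<close>), and two sets that are free over a common part have a joint position determined
  by their individual positions over that part (\<open>free_over_merge\<close>).

  Suppose first that \<open>A\<close> and \<open>B\<close> are free over \<open>C\<close>. By the mean ergodic argument,
  \<open>z\<close> is a limit of convex combinations of translates of \<open>\<xi>\<close> by the stabilizer of \<open>C\<close>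
  (\<open>fix_projection_in_orbit_hull\<close>). For \<open>\<eta>\<close> in \<open>H B\<close>, a translate of \<open>\<eta>\<close> belonging to a copy of
  \<open>B\<close> free from all sets involved in such a combination has inner product exactly \<open>\<langle>\<xi>, \<eta>\<rangle>\<close> with the
  combination, while its inner product with \<open>z\<close> is \<open>\<langle>z, \<eta>\<rangle>\<close>. Hence these two numbers agree
  (\<open>free_over_orthogonal\<close>).

  For general \<open>A\<close> and \<open>B\<close>, there may be relations between \<open>A\<close> and \<open>B\<close>, but one can choose
  arbitrarily many copies of \<open>A\<close> over \<open>B\<close> that are free from each other over \<open>B\<close>. Such copies are
  then free from each other over \<open>C\<close> (\<open>free_over_descend\<close>), so by the first case the corresponding
  translates of \<open>\<xi> - z\<close> are pairwise orthogonal. They have the same norm and the same inner product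
  with \<open>\<eta>\<close>, which must therefore be zero by Bessel's inequality.
\<close>

section \<open>Complex inner product spaces\<close>

lemma cinner_add_right: "cinner x (y + z) = cinner x y + cinner x (z::'h::complex_inner)"
  by (metis cinner_add_left cinner_commute complex_cnj_add)

lemma cinner_diff_left: "cinner (x - y) z = cinner x z - cinner y (z::'h::complex_inner)"
  using cinner_add_left[of "x - y" y z] by simp

lemma cinner_diff_right: "cinner x (y - z) = cinner x y - cinner x (z::'h::complex_inner)"
  using cinner_add_right[of x "y - z" z] by simp

lemma cinner_zero_left [simp]: "cinner 0 (z::'h::complex_inner) = 0"
  using cinner_diff_left[of 0 0 z] by simp

lemma cinner_zero_right [simp]: "cinner (z::'h::complex_inner) 0 = 0"
  using cinner_diff_right[of z 0 0] by simp

lemma cinner_scaleC_right: "cinner x (scaleC c y) = cnj c * cinner x (y::'h::complex_inner)"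
  by (metis cinner_commute cinner_scaleC_left complex_cnj_mult)

lemma cinner_scaleR_left: "cinner (r *\<^sub>R x) y = r *\<^sub>R cinner x (y::'h::complex_inner)"
  by (simp only: scaleR_scaleC[of r x] cinner_scaleC_left scaleR_conv_of_real)

lemma norm_power2_cinner: "(norm x)\<^sup>2 = Re (cinner x (x::'h::complex_inner))"
  by (simp add: cinner_self)

lemma parallelogram_law:
  "(norm (x - y))\<^sup>2 + (norm (x + y))\<^sup>2 = 2 * (norm x)\<^sup>2 + 2 * (norm (y::'h::complex_inner))\<^sup>2"
  by (simp add: norm_power2_cinner cinner_add_left cinner_add_right cinner_diff_left
      cinner_diff_right)

lemma norm_add_orthogonal:
  assumes "cinner x (y::'h::complex_inner) = 0"
  shows "(norm (x + y))\<^sup>2 = (norm x)\<^sup>2 + (norm y)\<^sup>2"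
proof -
  have "cinner y x = 0" using assms cinner_commute[of y x] by simp
  then show ?thesis
    using assms by (simp add: norm_power2_cinner cinner_add_left cinner_add_right)
qed

lemma norm_minus_component:
  assumes "(y::'h::complex_inner) \<noteq> 0"
  shows "(norm (x - scaleC (cinner x y / (norm y)\<^sup>2) y))\<^sup>2
    = (norm x)\<^sup>2 - (cmod (cinner x y))\<^sup>2 / (norm y)\<^sup>2"
proof -
  define a where "a = cinner x y"
  define N where "N = complex_of_real ((norm y)\<^sup>2)"
  have N: "N \<noteq> 0" "cnj N = N" "cinner y y = N" using assms by (auto simp: N_def cinner_self)
  have yx: "cinner y x = cnj a" unfolding a_def by (rule cinner_commute)
  have "complex_of_real ((norm (x - scaleC (a / N) y))\<^sup>2) =
      cinner (x - scaleC (a / N) y) (x - scaleC (a / N) y)"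
    by (simp add: cinner_self)
  also have "\<dots> = cinner x x - a * cnj a / N"
    using N yx by (simp add: cinner_diff_left cinner_diff_right cinner_scaleC_left
        cinner_scaleC_right a_def[symmetric] field_simps)
  also have "\<dots> = complex_of_real ((norm x)\<^sup>2 - (cmod a)\<^sup>2 / (norm y)\<^sup>2)"
    by (simp add: cinner_self N_def complex_norm_square[symmetric])
  finally show ?thesis
    unfolding a_def N_def by (simp only: of_real_eq_iff)
qed

lemma Cauchy_Schwarz_cinner: "cmod (cinner x y) \<le> norm x * norm (y::'h::complex_inner)"
proof (cases "y = 0")
  case False
  then have "0 \<le> (norm x)\<^sup>2 - (cmod (cinner x y))\<^sup>2 / (norm y)\<^sup>2"
    by (metis norm_minus_component zero_le_power2)
  then have "(cmod (cinner x y))\<^sup>2 \<le> (norm x * norm y)\<^sup>2"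
    using False by (simp add: field_simps power_mult_distrib)
  then show ?thesis by (rule power2_le_imp_le) simp
qed simp

lemma bounded_linear_cinner_left: "bounded_linear (\<lambda>x. cinner x (y::'h::complex_inner))"
  by (rule bounded_linear_intro[where K = "norm y"])
    (simp_all add: cinner_add_left cinner_scaleR_left Cauchy_Schwarz_cinner)

section \<open>Minimal vectors and orthogonal projections\<close>

text \<open>By the parallelogram law, two points of a convex set whose norms are close to the infimum are
  close to each other; hence a minimizing sequence is Cauchy.\<close>

lemma convex_midpoint_bound:
  fixes S :: "'h::complex_inner set"
  assumes "convex S" "x \<in> S" "y \<in> S" and d: "\<And>u. u \<in> S \<Longrightarrow> d \<le> norm u" "0 \<le> d"
  shows "(norm (x - y))\<^sup>2 \<le> 2 * (norm x)\<^sup>2 + 2 * (norm y)\<^sup>2 - 4 * d\<^sup>2"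
proof -
  have "(1/2) *\<^sub>R x + (1/2) *\<^sub>R y \<in> S"
    using assms by (intro convexD) auto
  then have "d \<le> norm ((1/2) *\<^sub>R (x + y))"
    using d by (simp add: scaleR_add_right)
  then have "2 * d \<le> norm (x + y)" by simp
  then have "(2 * d)\<^sup>2 \<le> (norm (x + y))\<^sup>2" using d(2) by (intro power_mono) auto
  then show ?thesis using parallelogram_law[of x y] by (simp add: power_mult_distrib)
qed

lemma minimal_norm_unique:
  fixes S :: "'h::complex_inner set"
  assumes "convex S" "x \<in> S" "y \<in> S" "\<And>u. u \<in> S \<Longrightarrow> norm x \<le> norm u" "norm y = norm x"
  shows "y = x"
  using convex_midpoint_bound[OF assms(1-4)] assms(5) by simp

lemma minimal_norm_exists:
  fixes S :: "'h::complex_hilbert_space set"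
  assumes "convex S" "closed S" "S \<noteq> {}"
  obtains z where "z \<in> S" "\<And>u. u \<in> S \<Longrightarrow> norm z \<le> norm u"
proof -
  define d where "d = Inf (norm ` S)"
  have bdd: "bdd_below (norm ` S)" by (rule bdd_belowI[of _ 0]) auto
  have d: "d \<le> norm u" if "u \<in> S" for u
    unfolding d_def using that bdd by (intro cInf_lower) auto
  have d0: "0 \<le> d" unfolding d_def using assms(3) by (intro cInf_greatest) auto
  have "\<exists>u\<in>S. (norm u)\<^sup>2 < d\<^sup>2 + e" if "e > 0" for e
  proof -
    have "d < sqrt (d\<^sup>2 + e)"
      using that d0 by (intro real_less_rsqrt) auto
    then obtain u where "u \<in> S" "norm u < sqrt (d\<^sup>2 + e)"
      using cInf_lessD[of "norm ` S"] assms(3) unfolding d_def by auto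
    moreover from this have "(norm u)\<^sup>2 < (sqrt (d\<^sup>2 + e))\<^sup>2"
      by (intro power_strict_mono) auto
    ultimately show ?thesis using that by auto
  qed
  then have "\<forall>n. \<exists>u\<in>S. (norm u)\<^sup>2 < d\<^sup>2 + inverse (real (Suc n))" by simp
  then obtain X where X: "\<And>n. X n \<in> S" "\<And>n. (norm (X n))\<^sup>2 < d\<^sup>2 + inverse (real (Suc n))"
    by metis
  have "Cauchy X"
  proof (rule metric_CauchyI)
    fix e :: real assume e: "0 < e"
    then obtain N where N: "inverse (real (Suc N)) < e\<^sup>2 / 4"
      using reals_Archimedean[of "e\<^sup>2 / 4"] by auto
    show "\<exists>N. \<forall>m\<ge>N. \<forall>n\<ge>N. dist (X m) (X n) < e"
    proof (intro exI allI impI)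
      fix m n assume mn: "N \<le> m" "N \<le> n"
      have *: "inverse (real (Suc k)) < e\<^sup>2 / 4" if "N \<le> k" for k
        using N that by (smt (verit) inverse_le_imp_le of_nat_0_less_iff of_nat_mono zero_less_Suc
            le_imp_inverse_le of_nat_Suc)
      have "(norm (X m - X n))\<^sup>2 < e\<^sup>2"
        using convex_midpoint_bound[OF assms(1) X(1)[of m] X(1)[of n] d d0] X(2)[of m] X(2)[of n]
          *[OF mn(1)] *[OF mn(2)] by linarith
      then show "dist (X m) (X n) < e"
        using e by (simp add: dist_norm power_less_imp_less_base)
    qed
  qed
  then obtain z where z: "X \<longlonglongrightarrow> z"
    using Cauchy_convergent convergent_def by blast
  have "z \<in> S" using closed_sequentially[OF assms(2) X(1) z] .
  have "(\<lambda>n. (norm (X n))\<^sup>2) \<longlonglongrightarrow> (norm z)\<^sup>2" by (intro tendsto_intros z)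
  moreover have "(\<lambda>n. d\<^sup>2 + inverse (real (Suc n))) \<longlonglongrightarrow> d\<^sup>2 + 0"
    by (intro tendsto_intros LIMSEQ_inverse_real_of_nat)
  ultimately have "(norm z)\<^sup>2 \<le> d\<^sup>2 + 0"
    by (rule LIMSEQ_le) (use X(2) in \<open>auto intro!: less_imp_le\<close>)
  then have "norm z \<le> d" using d0 power2_le_imp_le by auto
  then show ?thesis using that \<open>z \<in> S\<close> d by force
qed

definition closed_csubspace :: "'h::complex_inner set \<Rightarrow> bool" where
  "closed_csubspace S \<longleftrightarrow> closed S \<and> 0 \<in> S \<and> (\<forall>x\<in>S. \<forall>y\<in>S. x + y \<in> S) \<and>
     (\<forall>c. \<forall>x\<in>S. scaleC c x \<in> S)"

lemma closed_csubspace_diff: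
  assumes "closed_csubspace S" "x \<in> S" "y \<in> S"
  shows "x - y \<in> S"
proof -
  have "x - y = x + scaleC (- 1) y" using scaleR_scaleC[of "- 1" y] by simp
  then show ?thesis using assms unfolding closed_csubspace_def by metis
qed

lemma orthogonal_decomposition_unique:
  assumes S: "closed_csubspace S" and y: "y \<in> S" "\<And>z. z \<in> S \<Longrightarrow> cinner (x - y) z = 0"
    and y': "y' \<in> S" "\<And>z. z \<in> S \<Longrightarrow> cinner (x - y') z = 0"
  shows "y' = y"
proof -
  have "cinner (y' - y) (y' - y) = cinner (x - y) (y' - y) - cinner (x - y') (y' - y)"
    by (simp add: cinner_diff_left)
  also have "\<dots> = 0" using y y' closed_csubspace_diff[OF S y'(1) y(1)] by simp
  finally show ?thesis by (simp add: cinner_self)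
qed

text \<open>The nearest point \<open>y\<close> of \<open>S\<close> to \<open>x\<close> works: a component of \<open>x - y\<close> along a vector of \<open>S\<close>
  could be removed to come nearer.\<close>

lemma orthogonal_decomposition_exists:
  fixes S :: "'h::complex_hilbert_space set"
  assumes S: "closed_csubspace S"
  shows "\<exists>y\<in>S. \<forall>z\<in>S. cinner (x - y) z = 0"
proof -
  have S': "closed S" "0 \<in> S" "\<And>a b. a \<in> S \<Longrightarrow> b \<in> S \<Longrightarrow> a + b \<in> S"
    "\<And>c a. a \<in> S \<Longrightarrow> scaleC c a \<in> S" using S by (auto simp: closed_csubspace_def)
  let ?T = "(\<lambda>y. x - y) ` S"
  have "convex S" by (rule convexI) (simp add: S' scaleR_scaleC)
  moreover have T: "?T = (+) x ` uminus ` S" by (simp add: image_image)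
  ultimately have "convex ?T" by (simp only: convex_translation convex_negations)
  moreover have "closed ?T"
    unfolding T by (intro closed_translation closed_negations S')
  ultimately obtain w where w: "w \<in> ?T" "\<And>u. u \<in> ?T \<Longrightarrow> norm w \<le> norm u"
    using S'(2) minimal_norm_exists by (metis empty_iff image_is_empty)
  then obtain y where y: "y \<in> S" "w = x - y" by auto
  have "cinner w z = 0" if z: "z \<in> S" for z
  proof (cases "z = 0")
    case False
    define c where "c = cinner w z / (norm z)\<^sup>2"
    have "w - scaleC c z = x - (y + scaleC c z)" using y by simp
    then have "norm w \<le> norm (w - scaleC c z)" using w(2) y(1) z S' by blast
    then have "(norm w)\<^sup>2 \<le> (norm (w - scaleC c z))\<^sup>2" by (intro power_mono) auto
    then have "(cmod (cinner w z))\<^sup>2 / (norm z)\<^sup>2 \<le> 0"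
      using norm_minus_component[OF False, of w] unfolding c_def by linarith
    then show ?thesis using False by (simp add: divide_le_0_iff)
  qed simp
  then show ?thesis using y by auto
qed

lemma orth_proj_eqI:
  assumes "closed_csubspace S" "y \<in> S" "\<And>z. z \<in> S \<Longrightarrow> cinner (x - y) z = 0"
  shows "orth_proj S x = y"
  unfolding orth_proj_def
proof (rule the_equality)
  show "y \<in> S \<and> (\<forall>z\<in>S. cinner (x - y) z = 0)" using assms(2,3) by blast
  show "y' = y" if "y' \<in> S \<and> (\<forall>z\<in>S. cinner (x - y') z = 0)" for y'
    using that by (intro orthogonal_decomposition_unique[OF assms]) blast+
qed

section \<open>Automorphisms and free independence\<close>

text \<open>The plain notation for the inverse function is taken by inverses in groups.\<close>

abbreviation fun_inv :: "('a \<Rightarrow> 'b) \<Rightarrow> 'b \<Rightarrow> 'a" where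
  "fun_inv \<equiv> inv_into UNIV"

lemma Aut_permutes: "g \<in> carrier (Aut L M) \<Longrightarrow> g permutes universe M"
  by (simp add: Aut_def)

lemma Aut_rel_iff:
  assumes M: "is_structure L M" and g: "g \<in> carrier (Aut L M)" and R: "R \<in> symbols L"
  shows "map g xs \<in> rel M R \<longleftrightarrow> xs \<in> rel M R"
proof (cases "length xs = arity L R \<and> set xs \<subseteq> universe M")
  case True
  then show ?thesis using g R by (auto simp: Aut_def isomorphism_def embedding_def)
next
  case False
  then have "\<not> (length (map g xs) = arity L R \<and> set (map g xs) \<subseteq> universe M)"
    using permutes_in_image[OF Aut_permutes[OF g]] by auto
  then show ?thesis using False M R unfolding is_structure_def by blast
qed

lemma AutI:
  assumes "g permutes universe M"
    and "\<And>R xs. R \<in> symbols L \<Longrightarrow> set xs \<subseteq> universe M \<Longrightarrow> map g xs \<in> rel M R \<longleftrightarrow> xs \<in> rel M R"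
  shows "g \<in> carrier (Aut L M)"
  using assms permutes_image[OF assms(1)] permutes_inj_on[OF assms(1)]
  by (auto simp: Aut_def isomorphism_def embedding_def)

lemma Aut_id: "id \<in> carrier (Aut L M)"
  by (auto intro!: AutI permutes_id)

lemma Aut_comp:
  assumes "is_structure L M" "g \<in> carrier (Aut L M)" "h \<in> carrier (Aut L M)"
  shows "g \<circ> h \<in> carrier (Aut L M)"
proof (rule AutI)
  show "g \<circ> h permutes universe M" using assms by (blast intro: permutes_compose Aut_permutes)
  show "map (g \<circ> h) xs \<in> rel M R \<longleftrightarrow> xs \<in> rel M R" if "R \<in> symbols L" for R xs
    using Aut_rel_iff[OF assms(1) _ that] assms(2,3) by (metis map_map)
qed

lemma Aut_inv:
  assumes "is_structure L M" "g \<in> carrier (Aut L M)"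
  shows "fun_inv g \<in> carrier (Aut L M)"
proof (rule AutI)
  have p: "g permutes universe M" using assms by (rule_tac Aut_permutes)
  then show "fun_inv g permutes universe M" by (rule permutes_inv)
  show "map (fun_inv g) xs \<in> rel M R \<longleftrightarrow> xs \<in> rel M R" if "R \<in> symbols L" for R xs
    using Aut_rel_iff[OF assms that, of "map (fun_inv g) xs"] permutes_inverses[OF p]
    by (simp add: comp_def)
qed

lemma stabilizer_mono:
  "C \<subseteq> A \<Longrightarrow> pointwise_stabilizer G A \<subseteq> pointwise_stabilizer G C"
  by (auto simp: pointwise_stabilizer_def)

lemma ultrahomogeneous_extend:
  assumes "ultrahomogeneous L M" "finite A" "A \<subseteq> universe M"
    and "inj_on f A" "f ` A \<subseteq> universe M"
    and "\<And>R xs. R \<in> symbols L \<Longrightarrow> set xs \<subseteq> A \<Longrightarrow> map f xs \<in> rel M R \<longleftrightarrow> xs \<in> rel M R"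
  obtains g where "g \<in> carrier (Aut L M)" "\<And>x. x \<in> A \<Longrightarrow> g x = f x"
proof -
  have "isomorphism L (substructure M A) (substructure M (f ` A)) f"
    using assms(4,6) by (auto simp: isomorphism_def embedding_def substructure_def)
  then show ?thesis using assms that unfolding ultrahomogeneous_def by (metis finite_imageI)
qed

text \<open>For \<open>C\<close> contained in both \<open>A\<close> and \<open>B\<close>, this says that the substructure on \<open>A \<union> B\<close> is the free
  amalgam of those on \<open>A\<close> and \<open>B\<close> over \<open>C\<close>.\<close>

definition free_over ::
    "'r language \<Rightarrow> ('a, 'r) rel_structure \<Rightarrow> 'a set \<Rightarrow> 'a set \<Rightarrow> 'a set \<Rightarrow> bool" where
  "free_over L M C A B \<longleftrightarrow> A \<inter> B \<subseteq> C \<and>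
     (\<forall>R \<in> symbols L. \<forall>xs \<in> rel M R. set xs \<subseteq> A \<union> B \<longrightarrow> set xs \<subseteq> A \<or> set xs \<subseteq> B)"

lemma free_over_mono:
  assumes "free_over L M C A B" "C \<subseteq> A'" "A' \<subseteq> A"
  shows "free_over L M C A' B"
  unfolding free_over_def
proof (intro conjI ballI impI)
  show "A' \<inter> B \<subseteq> C" using assms by (auto simp: free_over_def)
  fix R xs assume R: "R \<in> symbols L" "xs \<in> rel M R" and xs: "set xs \<subseteq> A' \<union> B"
  have "set xs \<subseteq> A \<union> B" using xs assms(3) by blast
  then have "set xs \<subseteq> A \<or> set xs \<subseteq> B" using assms(1) R unfolding free_over_def by blast
  moreover have "A \<inter> B \<subseteq> A'" using assms(1,2) unfolding free_over_def by blast
  ultimately show "set xs \<subseteq> A' \<or> set xs \<subseteq> B" using xs by blast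
qed

text \<open>Amalgamation is a property of structures on sets of natural numbers. A fixed enumeration of the
  countable universe of \<open>M\<close> provides copies of all finite substructures that are compatible with
  inclusions.\<close>

definition nat_copy :: "('a, 'r) rel_structure \<Rightarrow> 'a set \<Rightarrow> (nat, 'r) rel_structure" where
  "nat_copy M A = \<lparr>universe = to_nat_on (universe M) ` A,
     rel = (\<lambda>R. map (to_nat_on (universe M)) ` {xs \<in> rel M R. set xs \<subseteq> A})\<rparr>"

lemma nat_copy_rel_iff:
  assumes "countable (universe M)" "A \<subseteq> universe M" "set xs \<subseteq> A"
  shows "map (to_nat_on (universe M)) xs \<in> rel (nat_copy M A) R \<longleftrightarrow> xs \<in> rel M R"
proof -
  have inj: "inj_on (to_nat_on (universe M)) A"
    using assms inj_on_subset inj_on_to_nat_on by blast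
  have "xs = ys" if "set ys \<subseteq> A"
    "map (to_nat_on (universe M)) xs = map (to_nat_on (universe M)) ys" for ys
    using map_inj_on[OF that(2)] inj_on_subset[OF inj, of "set xs \<union> set ys"] that assms by simp
  then show ?thesis using assms(3) by (auto simp: nat_copy_def)
qed

lemma nat_copy_in_Age:
  assumes "countable (universe M)" "is_structure L M" "finite A" "A \<subseteq> universe M"
  shows "nat_copy M A \<in> Age L M"
proof -
  let ?t = "to_nat_on (universe M)"
  let ?e = "from_nat_into (universe M)"
  have et: "?e (?t x) = x" if "x \<in> A" for x using that assms by auto
  have "is_structure L (nat_copy M A)"
    using assms(2) by (auto simp: is_structure_def nat_copy_def)
  moreover have "finite (universe (nat_copy M A))" using assms by (simp add: nat_copy_def)
  moreover have "embedding L (nat_copy M A) M ?e"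
    unfolding embedding_def
  proof (intro conjI ballI allI impI)
    show "inj_on ?e (universe (nat_copy M A))"
      by (rule inj_onI) (auto simp: nat_copy_def et)
    show "?e ` universe (nat_copy M A) \<subseteq> universe M"
      using assms(4) by (auto simp: nat_copy_def et)
    fix R xs assume "length xs = arity L R \<and> set xs \<subseteq> universe (nat_copy M A)"
    then have "xs \<in> lists (?t ` A)" by (auto simp: nat_copy_def)
    then obtain ys where ys: "ys \<in> lists A" "xs = map ?t ys"
      unfolding lists_image by auto
    then have "map ?e xs = ys" by (auto intro!: map_idI simp: et)
    then show "xs \<in> rel (nat_copy M A) R \<longleftrightarrow> map ?e xs \<in> rel M R"
      using nat_copy_rel_iff[OF assms(1,4), of ys R] ys by auto
  qed
  ultimately show ?thesis unfolding Age_def by blast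
qed

lemma nat_copy_embedding_mono:
  assumes "countable (universe M)" "A \<subseteq> B" "B \<subseteq> universe M"
  shows "embedding L (nat_copy M A) (nat_copy M B) id"
  unfolding embedding_def
proof (intro conjI ballI allI impI)
  show "id ` universe (nat_copy M A) \<subseteq> universe (nat_copy M B)"
    using assms by (auto simp: nat_copy_def)
  fix R xs assume "length xs = arity L R \<and> set xs \<subseteq> universe (nat_copy M A)"
  then have "xs \<in> lists (to_nat_on (universe M) ` A)" by (auto simp: nat_copy_def)
  then obtain ys where ys: "ys \<in> lists A" "xs = map (to_nat_on (universe M)) ys"
    unfolding lists_image by auto
  then show "xs \<in> rel (nat_copy M A) R \<longleftrightarrow> map id xs \<in> rel (nat_copy M B) R"
    using nat_copy_rel_iff[of M A ys R] nat_copy_rel_iff[of M B ys R] assms by auto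
qed simp

locale free_fraisse =
  fixes L :: "'r language" and M :: "('a, 'r) rel_structure"
  assumes fraisse: "fraisse_limit L M" and free: "free_amalgamation L M"
begin

abbreviation "G \<equiv> carrier (Aut L M)"
abbreviation "Stab \<equiv> pointwise_stabilizer (Aut L M)"

lemma M_facts: "is_structure L M" "countable (universe M)" "ultrahomogeneous L M"
  using fraisse by (auto simp: fraisse_limit_def)

lemma Aut_image_subset: "g \<in> G \<Longrightarrow> A \<subseteq> universe M \<Longrightarrow> g ` A \<subseteq> universe M"
  using Aut_permutes permutes_image by (metis image_mono)

lemma stabilizer_image: "g \<in> Stab C \<Longrightarrow> C \<subseteq> A \<Longrightarrow> C \<subseteq> g ` A"
  by (force simp: pointwise_stabilizer_def)

lemma Aut_inj: "g \<in> G \<Longrightarrow> g x = g y \<longleftrightarrow> x = y"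
  using Aut_permutes permutes_inj by (metis injD)

lemma stabilizer_moves_into:
  assumes "g \<in> Stab C" "g x \<in> C"
  shows "x \<in> C"
  using assms Aut_inj[of g "g x" x] by (auto simp: pointwise_stabilizer_def)

lemma nat_copy_embedding_rel_iff:
  assumes "embedding L (nat_copy M X) N f" "X \<subseteq> universe M" "R \<in> symbols L" "set xs \<subseteq> X"
    "length xs = arity L R"
  shows "map (f \<circ> to_nat_on (universe M)) xs \<in> rel N R \<longleftrightarrow> xs \<in> rel M R"
proof -
  let ?ys = "map (to_nat_on (universe M)) xs"
  have "length ?ys = arity L R" "set ?ys \<subseteq> universe (nat_copy M X)"
    using assms(4,5) by (auto simp: nat_copy_def)
  then have "map f ?ys \<in> rel N R \<longleftrightarrow> ?ys \<in> rel (nat_copy M X) R"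
    using assms(1,3) unfolding embedding_def by blast
  then show ?thesis using nat_copy_rel_iff[OF M_facts(2) assms(2,4), of R] by simp
qed

lemma embedding_rel_iff:
  assumes "embedding L (nat_copy M X) N f" "is_structure L N" "embedding L N M e"
    and "X \<subseteq> universe M" "R \<in> symbols L" "set xs \<subseteq> X"
  shows "map (e \<circ> f \<circ> to_nat_on (universe M)) xs \<in> rel M R \<longleftrightarrow> xs \<in> rel M R"
proof (cases "length xs = arity L R")
  case True
  let ?ys = "map (f \<circ> to_nat_on (universe M)) xs"
  have "set ?ys \<subseteq> universe N"
    using assms(1,6) by (auto simp: embedding_def nat_copy_def)
  then have "map e ?ys \<in> rel M R \<longleftrightarrow> ?ys \<in> rel N R"
    using assms(3,5) True unfolding embedding_def by auto
  then show ?thesis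
    using nat_copy_embedding_rel_iff[OF assms(1,4,5,6) True] by (simp add: comp_assoc)
next
  case False
  then show ?thesis using M_facts(1) assms(5) unfolding is_structure_def by fastforce
qed

text \<open>Amalgamate \<open>X\<close> and \<open>D\<close> freely over \<open>B\<close> and embed the amalgam into \<open>M\<close>; ultrahomogeneity first
  returns the copy of \<open>D\<close> to its place and then extends the map on \<open>X\<close> to an automorphism.\<close>

lemma free_copy_exists:
  assumes X: "finite X" "X \<subseteq> universe M" "B \<subseteq> X" and D: "finite D" "D \<subseteq> universe M" "B \<subseteq> D"
  obtains g where "g \<in> Stab B" "free_over L M B D (g ` X)"
proof -
  let ?t = "to_nat_on (universe M)"
  have B: "finite B" "B \<subseteq> universe M" using X finite_subset by auto
  have t_inj: "?t x = ?t y \<longleftrightarrow> x = y" if "x \<in> universe M" "y \<in> universe M" for x y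
    using that inj_on_to_nat_on[OF M_facts(2)] by (meson inj_onD)
  have ages: "nat_copy M B \<in> Age L M" "nat_copy M X \<in> Age L M" "nat_copy M D \<in> Age L M"
    using nat_copy_in_Age M_facts X D B by blast+
  have inclusions: "embedding L (nat_copy M B) (nat_copy M X) id"
    "embedding L (nat_copy M B) (nat_copy M D) id"
    using nat_copy_embedding_mono M_facts(2) X D by blast+
  note amalgam = free[unfolded free_amalgamation_def, THEN bspec, OF ages(1), THEN bspec,
      OF ages(2), THEN bspec, OF ages(3), THEN spec, THEN spec, THEN mp, OF conjI[OF inclusions]]
  from amalgam obtain N :: "(nat, 'r) rel_structure" and g1 g2 where N: "N \<in> Age L M"
    and g1: "embedding L (nat_copy M X) N g1" and g2: "embedding L (nat_copy M D) N g2"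
    and agree: "\<forall>a\<in>universe (nat_copy M B). g1 (id a) = g2 (id a)"
    and meet: "\<forall>b1\<in>universe (nat_copy M X). \<forall>b2\<in>universe (nat_copy M D). g1 b1 = g2 b2 \<longrightarrow>
       (\<exists>a\<in>universe (nat_copy M B). id a = b1 \<and> id a = b2)"
    and rels: "\<forall>R\<in>symbols L. \<forall>c\<in>rel N R. set c \<subseteq> g1 ` universe (nat_copy M X) \<or>
       set c \<subseteq> g2 ` universe (nat_copy M D)"
    by (elim bexE exE conjE) (rule that, assumption+)
  obtain e where N': "is_structure L N" and e: "embedding L N M e"
    using N by (auto simp: Age_def)
  have e_inj: "e x = e y \<longleftrightarrow> x = y" if "x \<in> universe N" "y \<in> universe N" for x y
    using that e by (auto simp: embedding_def inj_on_def)
  have g1_in: "g1 (?t x) \<in> universe N" if "x \<in> X" for x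
    using that g1 by (auto simp: embedding_def nat_copy_def)
  have g2_in: "g2 (?t x) \<in> universe N" if "x \<in> D" for x
    using that g2 by (auto simp: embedding_def nat_copy_def)
  have e_in: "e x \<in> universe M" if "x \<in> universe N" for x
    using that e by (auto simp: embedding_def)
  have g1_inj: "g1 (?t x) = g1 (?t y) \<longleftrightarrow> x = y" if "x \<in> X" "y \<in> X" for x y
    using that g1 t_inj[of x y] X(2) by (auto simp: embedding_def nat_copy_def inj_on_def)
  have g2_inj: "g2 (?t x) = g2 (?t y) \<longleftrightarrow> x = y" if "x \<in> D" "y \<in> D" for x y
    using that g2 t_inj[of x y] D(2) by (auto simp: embedding_def nat_copy_def inj_on_def)
  define u where "u = e \<circ> g2 \<circ> ?t"
  define v where "v = e \<circ> g1 \<circ> ?t"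
  obtain k where k: "k \<in> G" "\<And>x. x \<in> D \<Longrightarrow> k x = u x"
  proof (rule ultrahomogeneous_extend[OF M_facts(3) D(1,2), of u])
    show "inj_on u D" using g2_in g2_inj e_inj by (auto simp: u_def inj_on_def)
    show "u ` D \<subseteq> universe M" using g2_in e_in by (auto simp: u_def)
    show "map u xs \<in> rel M R \<longleftrightarrow> xs \<in> rel M R" if "R \<in> symbols L" "set xs \<subseteq> D" for R xs
      unfolding u_def by (rule embedding_rel_iff[OF g2 N' e D(2) that])
  qed (rule that)
  have kp: "k permutes universe M" using k(1) by (rule Aut_permutes)
  have ik: "fun_inv k \<in> G" using Aut_inv[OF M_facts(1) k(1)] .
  obtain g where g: "g \<in> G" "\<And>x. x \<in> X \<Longrightarrow> g x = fun_inv k (v x)"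
  proof (rule ultrahomogeneous_extend[OF M_facts(3) X(1,2), of "fun_inv k \<circ> v"])
    show "inj_on (fun_inv k \<circ> v) X"
      using g1_in g1_inj e_inj Aut_inj[OF ik] by (auto simp: v_def inj_on_def)
    show "(fun_inv k \<circ> v) ` X \<subseteq> universe M"
      using g1_in e_in permutes_in_image[OF Aut_permutes[OF ik]] by (auto simp: v_def)
    show "map (fun_inv k \<circ> v) xs \<in> rel M R \<longleftrightarrow> xs \<in> rel M R" if "R \<in> symbols L" "set xs \<subseteq> X" for R xs
      using embedding_rel_iff[OF g1 N' e X(2) that]
        Aut_rel_iff[OF M_facts(1) ik that(1), of "map v xs"] by (simp add: v_def comp_assoc)
  qed (use that in auto)
  have kg: "k (g x) = v x" if "x \<in> X" for x
    using g(2)[OF that] permutes_inverses[OF kp] by simp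
  have "g x = x" if "x \<in> B" for x
  proof -
    have x: "x \<in> X" "x \<in> D" using that X D by auto
    have "?t x \<in> universe (nat_copy M B)" using that by (simp add: nat_copy_def)
    then have "g1 (?t x) = g2 (?t x)" using agree by simp
    then have "k (g x) = k x" using kg[OF x(1)] k(2)[OF x(2)] by (simp add: u_def v_def)
    then show ?thesis using Aut_inj[OF k(1)] by simp
  qed
  then have "g \<in> Stab B" using g(1) by (simp add: pointwise_stabilizer_def)
  moreover have "free_over L M B D (g ` X)"
    unfolding free_over_def
  proof (intro conjI ballI impI subsetI)
    fix d assume "d \<in> D \<inter> g ` X"
    then obtain x where x: "x \<in> X" "d = g x" "d \<in> D" by auto
    then have "v x = u d" using kg k(2) by metis
    then have "g1 (?t x) = g2 (?t d)"
      using x g1_in g2_in e_inj by (auto simp: u_def v_def)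
    then have "?t x \<in> ?t ` B" "?t x = ?t d" using meet x by (auto simp: nat_copy_def)
    then obtain b where "b \<in> B" "?t b = ?t d" by (metis imageE)
    then show "d \<in> B" using t_inj[of b d] x D B by auto
  next
    fix R xs assume R: "R \<in> symbols L" and xs: "xs \<in> rel M R" "set xs \<subseteq> D \<union> g ` X"
    have len: "length xs = arity L R" using xs M_facts(1) R by (auto simp: is_structure_def)
    have "map k xs \<in> lists (e ` (g1 ` ?t ` X \<union> g2 ` ?t ` D))"
    proof -
      have "k x \<in> e ` (g1 ` ?t ` X \<union> g2 ` ?t ` D)" if x: "x \<in> set xs" for x
      proof (cases "x \<in> D")
        case True
        then show ?thesis using k(2) by (auto simp: u_def)
      next
        case False
        then obtain y where "y \<in> X" "x = g y" using xs x by blast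
        then show ?thesis using kg by (auto simp: v_def)
      qed
      then show ?thesis by auto
    qed
    then obtain c where c: "c \<in> lists (g1 ` ?t ` X \<union> g2 ` ?t ` D)" "map k xs = map e c"
      unfolding lists_image by auto
    have cN: "set c \<subseteq> universe N" using c(1) g1_in g2_in by auto
    have "map e c \<in> rel M R" using Aut_rel_iff[OF M_facts(1) k(1) R, of xs] xs c by simp
    moreover have "length c = arity L R" using len c(2) by (metis length_map)
    ultimately have "c \<in> rel N R" using e cN R unfolding embedding_def by blast
    then have cases: "set c \<subseteq> g1 ` ?t ` X \<or> set c \<subseteq> g2 ` ?t ` D"
      using rels R by (simp add: nat_copy_def)
    have kset: "k ` set xs = e ` set c" using c(2) by (metis set_map)
    show "set xs \<subseteq> D \<or> set xs \<subseteq> g ` X"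
      using cases
    proof
      assume *: "set c \<subseteq> g1 ` ?t ` X"
      have "x \<in> g ` X" if "x \<in> set xs" for x
      proof -
        have "k x \<in> e ` set c" unfolding kset[symmetric] using that by (rule imageI)
        then have "k x \<in> e ` g1 ` ?t ` X" by (rule subsetD[OF image_mono[OF *]])
        then obtain y where y: "y \<in> X" "k x = v y" by (auto simp: v_def)
        then show ?thesis using kg[of y] Aut_inj[OF k(1), of x "g y"] by auto
      qed
      then show ?thesis by blast
    next
      assume *: "set c \<subseteq> g2 ` ?t ` D"
      have "x \<in> D" if "x \<in> set xs" for x
      proof -
        have "k x \<in> e ` set c" unfolding kset[symmetric] using that by (rule imageI)
        then have "k x \<in> e ` g2 ` ?t ` D" by (rule subsetD[OF image_mono[OF *]])
        then obtain y where y: "y \<in> D" "k x = u y" by (auto simp: u_def)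
        then show ?thesis using k(2)[of y] Aut_inj[OF k(1), of x y] by auto
      qed
      then show ?thesis by blast
    qed
  qed
  ultimately show ?thesis by (rule that)
qed

text \<open>Stationarity: a free amalgam is determined by its two factors, so a pair of automorphisms over
  \<open>C\<close> carrying one free pair to another can be merged into a single automorphism.\<close>

lemma free_over_merge:
  assumes A: "finite A" "A \<subseteq> universe M" "C \<subseteq> A" and B: "finite B" "B \<subseteq> universe M" "C \<subseteq> B"
    and g: "g \<in> Stab C" and h: "h \<in> Stab C"
    and fr: "free_over L M C A B" and fr': "free_over L M C (g ` A) (h ` B)"
  obtains k where "k \<in> G" "\<And>x. x \<in> A \<Longrightarrow> k x = g x" "\<And>x. x \<in> B \<Longrightarrow> k x = h x"
proof -
  have gG: "g \<in> G" "\<And>x. x \<in> C \<Longrightarrow> g x = x" and hG: "h \<in> G" "\<And>x. x \<in> C \<Longrightarrow> h x = x"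
    using g h by (auto simp: pointwise_stabilizer_def)
  define f where "f x = (if x \<in> A then g x else h x)" for x
  have fA: "f x = g x" if "x \<in> A" for x using that by (simp add: f_def)
  have fB: "f x = h x" if "x \<in> B" for x
    using that fr gG(2) hG(2) by (auto simp: f_def free_over_def)
  have cross: "x \<in> C" "y \<in> C" if "x \<in> A" "y \<in> B" "g x = h y" for x y
  proof -
    have "g x \<in> C" "h y \<in> C" using that fr' unfolding free_over_def by auto
    then show "x \<in> C" "y \<in> C" using stabilizer_moves_into g h by blast+
  qed
  have "\<exists>k\<in>G. \<forall>x\<in>A \<union> B. k x = f x"
  proof (rule ultrahomogeneous_extend[OF M_facts(3), of "A \<union> B" f])
    show "inj_on f (A \<union> B)"
    proof (rule inj_onI)
      fix x y assume xy: "x \<in> A \<union> B" "y \<in> A \<union> B" "f x = f y"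
      consider "x \<in> A" "y \<in> A" | "x \<in> B" "y \<in> B" | "x \<in> A" "y \<in> B" | "x \<in> B" "y \<in> A"
        using xy by blast
      then show "x = y"
      proof cases
        case 1 then show ?thesis using xy fA Aut_inj[OF gG(1)] by simp
      next
        case 2 then show ?thesis using xy fB Aut_inj[OF hG(1)] by simp
      next
        case 3
        then have "g x = h y" using xy(3) fA fB by simp
        then show ?thesis using cross[OF 3] gG(2) hG(2) by metis
      next
        case 4
        then have "g y = h x" using xy(3) fA fB by simp
        then show ?thesis using cross[OF 4(2,1)] gG(2) hG(2) by metis
      qed
    qed
    show "f ` (A \<union> B) \<subseteq> universe M"
      using Aut_image_subset[OF gG(1) A(2)] Aut_image_subset[OF hG(1) B(2)] fA fB by force
    fix R xs assume R: "R \<in> symbols L" and xs: "set xs \<subseteq> A \<union> B"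
    have inA: "map f xs \<in> rel M R \<longleftrightarrow> xs \<in> rel M R" if "set xs \<subseteq> A"
    proof -
      have "map f xs = map g xs" using that fA by auto
      then show ?thesis by (simp only: Aut_rel_iff[OF M_facts(1) gG(1) R])
    qed
    have inB: "map f xs \<in> rel M R \<longleftrightarrow> xs \<in> rel M R" if "set xs \<subseteq> B"
    proof -
      have "map f xs = map h xs" using that fB by auto
      then show ?thesis by (simp only: Aut_rel_iff[OF M_facts(1) hG(1) R])
    qed
    have "set xs \<subseteq> A \<or> set xs \<subseteq> B" if "xs \<in> rel M R"
      using fr R xs that by (auto simp: free_over_def)
    moreover have "set xs \<subseteq> A \<or> set xs \<subseteq> B" if "map f xs \<in> rel M R"
    proof -
      have "set (map f xs) \<subseteq> g ` A \<union> h ` B" using xs fA fB by force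
      then have "set (map f xs) \<subseteq> g ` A \<or> set (map f xs) \<subseteq> h ` B"
        using fr' R that unfolding free_over_def by blast
      then show ?thesis
      proof
        assume *: "set (map f xs) \<subseteq> g ` A"
        have "x \<in> A" if "x \<in> set xs" for x
        proof (rule ccontr)
          assume "x \<notin> A"
          then have "x \<in> B" "h x \<in> g ` A" using that xs * fB by force+
          then show False using cross(2) \<open>x \<notin> A\<close> A(3) by (metis imageE subsetD)
        qed
        then show ?thesis by blast
      next
        assume *: "set (map f xs) \<subseteq> h ` B"
        have "x \<in> B" if "x \<in> set xs" for x
        proof (rule ccontr)
          assume "x \<notin> B"
          then have "x \<in> A" "g x \<in> h ` B" using that xs * fA by force+
          then show False using cross(1) \<open>x \<notin> B\<close> B(3) by (metis imageE subsetD)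
        qed
        then show ?thesis by blast
      qed
    qed
    ultimately show "map f xs \<in> rel M R \<longleftrightarrow> xs \<in> rel M R" using inA inB by blast
  qed (use A B in auto)
  then show ?thesis using that fA fB by auto
qed

text \<open>Two copies of \<open>A\<close> that are free over \<open>B\<close> are free already over \<open>A \<inter> B\<close>, whatever relations hold
  between \<open>A\<close> and \<open>B\<close>: an element of one copy that lies in the other copy extended by \<open>B\<close> must lie in
  \<open>B\<close>, hence in the common part.\<close>

lemma free_over_descend:
  assumes h: "h \<in> Stab B" and h': "h' \<in> Stab B"
    and fr: "free_over L M B (h ` (A \<union> B)) (h' ` (A \<union> B))"
  shows "free_over L M (A \<inter> B) (h ` A) (h' ` A)"
proof -
  have *: "y \<in> A \<inter> B" if y: "y \<in> f ` A" "y \<in> B" and f: "f \<in> Stab B" for y f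
  proof -
    obtain x where x: "x \<in> A" "y = f x" using y(1) by auto
    then have "x \<in> B" using stabilizer_moves_into[OF f] y(2) by blast
    then have "f x = x" using f by (simp add: pointwise_stabilizer_def)
    then show ?thesis using x y by simp
  qed
  have sub: "A \<inter> B \<subseteq> h ` A" "A \<inter> B \<subseteq> h' ` A"
    using stabilizer_image stabilizer_mono[of "A \<inter> B" B] h h' by blast+
  have meet: "h ` (A \<union> B) \<inter> h' ` (A \<union> B) \<subseteq> B" using fr by (simp add: free_over_def)
  show ?thesis
    unfolding free_over_def
  proof (intro conjI ballI impI)
    show "h ` A \<inter> h' ` A \<subseteq> A \<inter> B" using meet * h by blast
    fix R xs assume "R \<in> symbols L" "xs \<in> rel M R" and xs: "set xs \<subseteq> h ` A \<union> h' ` A"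
    moreover from xs have "set xs \<subseteq> h ` (A \<union> B) \<union> h' ` (A \<union> B)" by blast
    ultimately consider "set xs \<subseteq> h ` (A \<union> B)" | "set xs \<subseteq> h' ` (A \<union> B)"
      using fr unfolding free_over_def by blast
    then show "set xs \<subseteq> h ` A \<or> set xs \<subseteq> h' ` A"
    proof cases
      case 1
      have "y \<in> h ` A" if "y \<in> set xs" for y
      proof (rule ccontr)
        assume "y \<notin> h ` A"
        then have "y \<in> h' ` A" "y \<in> B" using that xs 1 meet by blast+
        then show False using *[OF _ _ h'] sub \<open>y \<notin> h ` A\<close> by blast
      qed
      then show ?thesis by blast
    next
      case 2
      have "y \<in> h' ` A" if "y \<in> set xs" for y
      proof (rule ccontr)
        assume "y \<notin> h' ` A"
        then have "y \<in> h ` A" "y \<in> B" using that xs 2 meet by blast+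
        then show False using *[OF _ _ h] sub \<open>y \<notin> h' ` A\<close> by blast
      qed
      then show ?thesis by blast
    qed
  qed
qed

end

section \<open>Fixed vectors of unitary representations\<close>

locale free_fraisse_rep = free_fraisse L M
  for L :: "'r language" and M :: "('a, 'r) rel_structure" +
  fixes \<pi> :: "('a \<Rightarrow> 'a) \<Rightarrow> 'h \<Rightarrow> 'h::complex_hilbert_space"
  assumes rep: "unitary_rep (Aut L M) \<pi>"
begin

abbreviation "Fix \<equiv> fixed_vectors (Aut L M) \<pi>"

lemma rep_unitary: "g \<in> G \<Longrightarrow> unitary (\<pi> g)"
  using rep by (auto simp: unitary_rep_def hom_def unitary_group_def)

lemma rep_comp: "g \<in> G \<Longrightarrow> h \<in> G \<Longrightarrow> \<pi> (g \<circ> h) x = \<pi> g (\<pi> h x)"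
  using rep by (auto simp: unitary_rep_def hom_def unitary_group_def Aut_def)

lemma rep_cinner: "g \<in> G \<Longrightarrow> cinner (\<pi> g x) (\<pi> g y) = cinner x y"
  using rep_unitary by (simp add: unitary_def)

lemma rep_norm: "g \<in> G \<Longrightarrow> norm (\<pi> g x) = norm x"
  using rep_cinner[of g x x] by (metis norm_power2_cinner norm_ge_zero power2_eq_imp_eq)

lemma rep_add: "g \<in> G \<Longrightarrow> \<pi> g (x + y) = \<pi> g x + \<pi> g y"
  using rep_unitary by (simp add: unitary_def Vector_Spaces.linear_iff)

lemma rep_scaleC: "g \<in> G \<Longrightarrow> \<pi> g (scaleC c x) = scaleC c (\<pi> g x)"
  using rep_unitary by (simp add: unitary_def Vector_Spaces.linear_iff)

lemma rep_diff: "g \<in> G \<Longrightarrow> \<pi> g (x - y) = \<pi> g x - \<pi> g y"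
  using rep_add[of g "x - y" y] by (simp add: algebra_simps)

lemma rep_bounded_linear: "g \<in> G \<Longrightarrow> bounded_linear (\<pi> g)"
  by (rule bounded_linear_intro[where K = 1])
    (simp_all add: rep_add scaleR_scaleC rep_scaleC rep_norm)

lemma rep_id: "\<pi> id x = x"
proof -
  obtain y where "x = \<pi> id y"
    using rep_unitary[OF Aut_id] by (meson unitary_def surjD)
  then show ?thesis using rep_comp[OF Aut_id Aut_id, of y] by simp
qed

lemma rep_inv:
  assumes "g \<in> G"
  shows "\<pi> (fun_inv g) (\<pi> g x) = x" and "\<pi> g (\<pi> (fun_inv g) x) = x"
  using rep_comp[of "fun_inv g" g x] rep_comp[of g "fun_inv g" x] Aut_inv[OF M_facts(1) assms]
    rep_id[of x] permutes_inv_o[OF Aut_permutes[OF assms]] assms by simp_all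

lemma fixD: "\<xi> \<in> Fix A \<Longrightarrow> g \<in> Stab A \<Longrightarrow> \<pi> g \<xi> = \<xi>"
  by (simp add: fixed_vectors_def)

lemma fix_mono: "A \<subseteq> B \<Longrightarrow> Fix A \<subseteq> Fix B"
  using stabilizer_mono[of A B] by (auto simp: fixed_vectors_def)

lemma fix_image:
  assumes "g \<in> G" "\<xi> \<in> Fix A"
  shows "\<pi> g \<xi> \<in> Fix (g ` A)"
  unfolding fixed_vectors_def
proof (intro CollectI ballI)
  fix h assume h: "h \<in> Stab (g ` A)"
  then have hG: "h \<in> G" by (simp add: pointwise_stabilizer_def)
  have ig: "fun_inv g \<in> G" using Aut_inv[OF M_facts(1) assms(1)] .
  have k: "fun_inv g \<circ> (h \<circ> g) \<in> G" using Aut_comp[OF M_facts(1)] hG ig assms(1) by blast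
  have "fun_inv g \<circ> (h \<circ> g) \<in> Stab A"
    using h k permutes_inverses[OF Aut_permutes[OF assms(1)]]
    by (auto simp: pointwise_stabilizer_def)
  then have "\<pi> (fun_inv g \<circ> (h \<circ> g)) \<xi> = \<xi>" by (rule fixD[OF assms(2)])
  then have "\<pi> (fun_inv g) (\<pi> h (\<pi> g \<xi>)) = \<xi>"
    using rep_comp ig hG assms(1) Aut_comp[OF M_facts(1) hG assms(1)] by simp
  then show "\<pi> h (\<pi> g \<xi>) = \<pi> g \<xi>" using rep_inv(2)[OF assms(1)] by metis
qed

lemma rep_eq_of_agree:
  assumes "g \<in> G" "k \<in> G" "\<xi> \<in> Fix A" "\<And>x. x \<in> A \<Longrightarrow> k x = g x"
  shows "\<pi> k \<xi> = \<pi> g \<xi>"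
proof -
  have ig: "fun_inv g \<in> G" using Aut_inv[OF M_facts(1) assms(1)] .
  have "fun_inv g \<circ> k \<in> Stab A"
    using assms Aut_comp[OF M_facts(1) ig assms(2)] permutes_inverses[OF Aut_permutes[OF assms(1)]]
    by (auto simp: pointwise_stabilizer_def)
  then have "\<pi> (fun_inv g) (\<pi> k \<xi>) = \<xi>" using fixD[OF assms(3)] rep_comp[OF ig assms(2)] by metis
  then show ?thesis using rep_inv(2)[OF assms(1)] by metis
qed

lemma fix_closed_csubspace: "closed_csubspace (Fix A)"
proof -
  have "closed {\<xi>. \<pi> g \<xi> = \<xi>}" if "g \<in> G" for g
    using linear_continuous_on[OF rep_bounded_linear[OF that]]
    by (intro closed_Collect_eq) auto
  moreover have "Fix A = (\<Inter>g\<in>Stab A. {\<xi>. \<pi> g \<xi> = \<xi>})" by (auto simp: fixed_vectors_def)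
  ultimately have "closed (Fix A)" by (auto simp: pointwise_stabilizer_def)
  then show ?thesis
    using rep_diff[of _ 0 0]
    by (auto simp: closed_csubspace_def fixed_vectors_def pointwise_stabilizer_def rep_add rep_scaleC)
qed

text \<open>The projection of \<open>\<xi>\<close> onto the fixed vectors of \<open>Stab C\<close> is the vector of minimal norm in the
  closed convex hull of its orbit: by uniqueness that vector is fixed, and all points of the hull have
  the same inner products with fixed vectors.\<close>

lemma fix_projection_in_orbit_hull:
  assumes z: "z \<in> Fix C" "\<And>w. w \<in> Fix C \<Longrightarrow> cinner (\<xi> - z) w = 0"
  shows "z \<in> closure (convex hull ((\<lambda>g. \<pi> g \<xi>) ` Stab C))" (is "_ \<in> ?K")
proof -
  let ?O = "(\<lambda>g. \<pi> g \<xi>) ` Stab C"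
  have StabG: "g \<in> G" if "g \<in> Stab C" for g using that by (simp add: pointwise_stabilizer_def)
  have O_K: "?O \<subseteq> ?K" using hull_subset closure_subset by (metis order_trans)
  have K: "?K \<subseteq> T" if "?O \<subseteq> T" "convex T" "closed T" for T
    using that by (intro closure_minimal hull_minimal)
  have "id \<in> Stab C" using Aut_id by (auto simp: pointwise_stabilizer_def)
  then have "\<pi> id \<xi> \<in> ?K" by (intro subsetD[OF O_K] imageI)
  then have "?K \<noteq> {}" by (metis empty_iff)
  then obtain y where y: "y \<in> ?K" "\<And>u. u \<in> ?K \<Longrightarrow> norm y \<le> norm u"
    using minimal_norm_exists[of ?K] by (auto simp: convex_closure)
  have "\<pi> h y = y" if h: "h \<in> Stab C" for h
  proof -
    have "?K \<subseteq> \<pi> h -` ?K"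
    proof (rule K)
      have "\<pi> h (\<pi> g \<xi>) \<in> ?O" if g: "g \<in> Stab C" for g
      proof -
        have "h \<circ> g \<in> Stab C"
          using g h Aut_comp[OF M_facts(1)] by (auto simp: pointwise_stabilizer_def)
        then show ?thesis using rep_comp[OF StabG[OF h] StabG[OF g]] by (metis imageI)
      qed
      then show "?O \<subseteq> \<pi> h -` ?K" using O_K by blast
      show "convex (\<pi> h -` ?K)"
        using rep_bounded_linear[OF StabG[OF h]]
        by (intro convex_linear_vimage) (auto simp: bounded_linear.linear convex_closure)
      show "closed (\<pi> h -` ?K)"
        using linear_continuous_on[OF rep_bounded_linear[OF StabG[OF h]], of UNIV]
        by (intro closed_vimage) auto
    qed
    then have "\<pi> h y \<in> ?K" using y by blast
    then show ?thesis
      using minimal_norm_unique[of ?K y "\<pi> h y"] y rep_norm[OF StabG[OF h]]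
      by (simp add: convex_closure)
  qed
  then have yC: "y \<in> Fix C" by (simp add: fixed_vectors_def)
  have y_perp: "cinner (\<xi> - y) w = 0" if w: "w \<in> Fix C" for w
  proof -
    have "?K \<subseteq> (\<lambda>x. cinner x w) -` {cinner \<xi> w}"
    proof (rule K)
      have "cinner (\<pi> g \<xi>) w = cinner \<xi> w" if "g \<in> Stab C" for g
        using rep_cinner[OF StabG[OF that], of \<xi> w] fixD[OF w that] by simp
      then show "?O \<subseteq> (\<lambda>x. cinner x w) -` {cinner \<xi> w}" by auto
      show "convex ((\<lambda>x. cinner x w) -` {cinner \<xi> w})"
        by (intro convex_linear_vimage) (auto simp: bounded_linear.linear bounded_linear_cinner_left)
      show "closed ((\<lambda>x. cinner x w) -` {cinner \<xi> w})"
        using linear_continuous_on[OF bounded_linear_cinner_left, of UNIV]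
        by (intro closed_vimage) auto
    qed
    then show ?thesis using y(1) by (auto simp: cinner_diff_left)
  qed
  have "y = z" by (rule orthogonal_decomposition_unique[OF fix_closed_csubspace z yC y_perp])
  then show ?thesis using y by simp
qed

text \<open>Approximate \<open>z\<close> by a convex combination of translates of \<open>\<xi>\<close>. It involves finitely many
  copies of \<open>A\<close>; a translate of \<open>\<eta>\<close> by some \<open>h\<close> moving \<open>B\<close> free from all of them over \<open>C\<close> has, by
  stationarity, the same inner product with each translate of \<open>\<xi>\<close> as \<open>\<eta>\<close> has with \<open>\<xi>\<close>.\<close>

lemma free_over_orthogonal:
  assumes A: "finite A" "A \<subseteq> universe M" "C \<subseteq> A" and B: "finite B" "B \<subseteq> universe M" "C \<subseteq> B"
    and fr: "free_over L M C A B" and \<xi>: "\<xi> \<in> Fix A" and \<eta>: "\<eta> \<in> Fix B"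
    and z: "z \<in> Fix C" "\<And>w. w \<in> Fix C \<Longrightarrow> cinner (\<xi> - z) w = 0"
  shows "cinner (\<xi> - z) \<eta> = 0"
proof -
  let ?O = "(\<lambda>g. \<pi> g \<xi>) ` Stab C"
  have StabG: "g \<in> G" if "g \<in> Stab C" for g using that by (simp add: pointwise_stabilizer_def)
  \<comment> \<open>\<open>D\<close> collects the points of the copies of \<open>A\<close> that contribute to the combination \<open>k\<close>.\<close>
  define good where "good D k \<longleftrightarrow> finite D \<and> D \<subseteq> universe M \<and> C \<subseteq> D \<and>
     (\<forall>h\<in>Stab C. free_over L M C D (h ` B) \<longrightarrow> cinner k (\<pi> h \<eta>) = cinner \<xi> \<eta>)" for D k
  have "convex hull ?O \<subseteq> {k. \<exists>D. good D k}"
  proof (rule hull_minimal)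
    have "good (g ` A) (\<pi> g \<xi>)" if g: "g \<in> Stab C" for g
      unfolding good_def
    proof (intro conjI ballI impI)
      show "finite (g ` A)" "g ` A \<subseteq> universe M" "C \<subseteq> g ` A"
        using A Aut_image_subset[OF StabG[OF g]] stabilizer_image[OF g] by auto
      fix h assume h: "h \<in> Stab C" "free_over L M C (g ` A) (h ` B)"
      obtain k where k: "k \<in> G" "\<And>x. x \<in> A \<Longrightarrow> k x = g x" "\<And>x. x \<in> B \<Longrightarrow> k x = h x"
        using free_over_merge[OF A B g h(1) fr h(2)] by blast
      have "\<pi> k \<xi> = \<pi> g \<xi>" "\<pi> k \<eta> = \<pi> h \<eta>"
        using rep_eq_of_agree[OF StabG[OF g] k(1) \<xi> k(2)]
          rep_eq_of_agree[OF StabG[OF h(1)] k(1) \<eta> k(3)] by auto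
      then show "cinner (\<pi> g \<xi>) (\<pi> h \<eta>) = cinner \<xi> \<eta>" using rep_cinner[OF k(1), of \<xi> \<eta>] by simp
    qed
    then show "?O \<subseteq> {k. \<exists>D. good D k}" by blast
    show "convex {k. \<exists>D. good D k}"
    proof (rule convexI)
      fix x y and u v :: real
      assume "x \<in> {k. \<exists>D. good D k}" "y \<in> {k. \<exists>D. good D k}" and uv: "u + v = 1"
      then obtain D E where D: "good D x" and E: "good E y" by blast
      have "cinner (u *\<^sub>R x + v *\<^sub>R y) (\<pi> h \<eta>) = cinner \<xi> \<eta>"
        if h: "h \<in> Stab C" "free_over L M C (D \<union> E) (h ` B)" for h
      proof -
        have "free_over L M C D (h ` B)" "free_over L M C E (h ` B)"
          using free_over_mono[OF h(2)] D E by (auto simp: good_def)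
        then have "cinner x (\<pi> h \<eta>) = cinner \<xi> \<eta>" "cinner y (\<pi> h \<eta>) = cinner \<xi> \<eta>"
          using D E h by (auto simp: good_def)
        then show ?thesis using uv
          by (simp add: cinner_add_left cinner_scaleR_left flip: scaleR_add_left)
      qed
      then have "good (D \<union> E) (u *\<^sub>R x + v *\<^sub>R y)" using D E unfolding good_def by auto
      then show "u *\<^sub>R x + v *\<^sub>R y \<in> {k. \<exists>D. good D k}" by blast
    qed
  qed
  moreover have "z \<in> closure (convex hull ?O)"
    by (rule fix_projection_in_orbit_hull[OF z])
  ultimately have z_cl: "\<exists>k D. good D k \<and> dist k z < e" if "e > 0" for e
    using that unfolding closure_approachable by blast
  have small: "cmod (cinner (\<xi> - z) \<eta>) \<le> e * norm \<eta>" if e: "e > 0" for e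
  proof -
    obtain k D where k: "good D k" "dist k z < e" using z_cl[OF e] by blast
    obtain h where h: "h \<in> Stab C" "free_over L M C D (h ` B)"
      using free_copy_exists[OF B, of D] k by (auto simp: good_def)
    have "cinner z (\<pi> h \<eta>) = cinner z \<eta>"
      using rep_cinner[OF StabG[OF h(1)], of z \<eta>] fixD[OF z(1) h(1)] by simp
    then have "cinner (\<xi> - z) \<eta> = cinner (k - z) (\<pi> h \<eta>)"
      using k(1) h by (simp add: good_def cinner_diff_left)
    also have "cmod \<dots> \<le> norm (k - z) * norm (\<pi> h \<eta>)" by (rule Cauchy_Schwarz_cinner)
    also have "\<dots> \<le> e * norm \<eta>"
      using k(2) rep_norm[OF StabG[OF h(1)]] by (simp add: dist_norm mult_right_mono)
    finally show ?thesis .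
  qed
  have "cmod (cinner (\<xi> - z) \<eta>) \<le> 0 + e" if "e > 0" for e
  proof -
    have "cmod (cinner (\<xi> - z) \<eta>) \<le> e / (norm \<eta> + 1) * norm \<eta>"
      using that by (intro small) (simp add: add_nonneg_pos)
    also have "\<dots> \<le> e / (norm \<eta> + 1) * (norm \<eta> + 1)"
      using that by (intro mult_left_mono) auto
    also have "\<dots> = e" using add_nonneg_pos[OF norm_ge_zero[of \<eta>], of 1] by simp
    finally show ?thesis by simp
  qed
  then have "cmod (cinner (\<xi> - z) \<eta>) \<le> 0" by (rule field_le_epsilon)
  then show ?thesis by simp
qed

text \<open>Translates of \<open>\<xi> - z\<close> by elements of \<open>Stab B\<close> all have the same inner product with \<open>\<eta>\<close>. Those
  belonging to copies of \<open>A \<union> B\<close> that are free over \<open>B\<close> are pairwise orthogonal, and there are arbitrarily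
  many of them, so Bessel's inequality forces this inner product to vanish.\<close>

lemma fix_orthogonal:
  assumes A: "finite A" "A \<subseteq> universe M" and B: "finite B" "B \<subseteq> universe M"
    and \<xi>: "\<xi> \<in> Fix A" and \<eta>: "\<eta> \<in> Fix B"
    and z: "z \<in> Fix (A \<inter> B)" "\<And>w. w \<in> Fix (A \<inter> B) \<Longrightarrow> cinner (\<xi> - z) w = 0"
  shows "cinner (\<xi> - z) \<eta> = 0"
proof -
  let ?X = "A \<union> B"
  define \<zeta> where "\<zeta> = \<xi> - z"
  define d where "d = cinner \<zeta> \<eta>"
  have X: "finite ?X" "?X \<subseteq> universe M" "B \<subseteq> ?X" using A B by auto
  have StabG: "g \<in> G" "g \<in> Stab (A \<inter> B)" if "g \<in> Stab B" for g
    using that by (auto simp: pointwise_stabilizer_def)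
  have orth: "cinner (\<pi> h \<zeta>) (\<pi> h' \<zeta>) = 0"
    if h: "h \<in> Stab B" "h' \<in> Stab B" and fr: "free_over L M B (h ` ?X) (h' ` ?X)" for h h'
  proof -
    let ?C = "A \<inter> B"
    have fr': "free_over L M ?C (h ` A) (h' ` A)" using free_over_descend[OF h fr] .
    have fin: "finite (h ` A)" "h ` A \<subseteq> universe M" "?C \<subseteq> h ` A"
      "finite (h' ` A)" "h' ` A \<subseteq> universe M" "?C \<subseteq> h' ` A"
      using A Aut_image_subset StabG h stabilizer_image by (simp_all add: inf.coboundedI1)
    have hz: "\<pi> f \<zeta> = \<pi> f \<xi> - z" if "f \<in> Stab B" for f
      using rep_diff[OF StabG(1)[OF that]] fixD[OF z(1) StabG(2)[OF that]] by (simp add: \<zeta>_def)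
    have "cinner (\<pi> h \<xi> - z) w = 0" if "w \<in> Fix ?C" for w
      using rep_cinner[OF StabG(1)[OF h(1)], of \<zeta> w] fixD[OF that StabG(2)[OF h(1)]]
        z(2)[OF that] hz[OF h(1)] by (simp add: \<zeta>_def)
    then have *: "cinner (\<pi> h \<xi> - z) w = 0" if "w \<in> Fix (h' ` A)" for w
      using free_over_orthogonal[OF fin fr' fix_image[OF StabG(1)[OF h(1)] \<xi>] that z(1)] by blast
    have "\<pi> h' \<xi> \<in> Fix (h' ` A)" "z \<in> Fix (h' ` A)"
      using fix_image[OF StabG(1)[OF h(2)] \<xi>] z(1) fix_mono[OF fin(6)] by blast+
    then show ?thesis using * by (simp add: hz h cinner_diff_right)
  qed
  \<comment> \<open>\<open>s\<close> is a sum of \<open>n\<close> orthogonal translates of \<open>\<zeta>\<close>, supported on the finite set \<open>D\<close>; the last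
    clause makes every further translate that is free from \<open>D\<close> orthogonal to it.\<close>
  have sums: "\<exists>s D. finite D \<and> D \<subseteq> universe M \<and> B \<subseteq> D \<and> (norm s)\<^sup>2 = real n * (norm \<zeta>)\<^sup>2 \<and>
      cinner s \<eta> = of_nat n * d \<and>
      (\<forall>h\<in>Stab B. free_over L M B D (h ` ?X) \<longrightarrow> cinner s (\<pi> h \<zeta>) = 0)" for n
  proof (induction n)
    case 0
    show ?case using B by (intro exI[of _ 0] exI[of _ B]) auto
  next
    case (Suc n)
    then obtain s D where D: "finite D" "D \<subseteq> universe M" "B \<subseteq> D"
      and s: "(norm s)\<^sup>2 = real n * (norm \<zeta>)\<^sup>2" "cinner s \<eta> = of_nat n * d"
      and perp: "\<And>h. h \<in> Stab B \<Longrightarrow> free_over L M B D (h ` ?X) \<Longrightarrow> cinner s (\<pi> h \<zeta>) = 0"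
      by blast
    obtain h where h: "h \<in> Stab B" "free_over L M B D (h ` ?X)"
      using free_copy_exists[OF X D] by blast
    have hX: "finite (h ` ?X)" "h ` ?X \<subseteq> universe M" "B \<subseteq> h ` ?X"
      using X Aut_image_subset[OF StabG(1)[OF h(1)]] stabilizer_image[OF h(1)] by blast+
    have "(norm (s + \<pi> h \<zeta>))\<^sup>2 = real (Suc n) * (norm \<zeta>)\<^sup>2"
      using norm_add_orthogonal[OF perp[OF h]] s(1) rep_norm[OF StabG(1)[OF h(1)]]
      by (simp add: algebra_simps)
    moreover have "cinner (\<pi> h \<zeta>) \<eta> = d"
      using rep_cinner[OF StabG(1)[OF h(1)], of \<zeta> \<eta>] fixD[OF \<eta> h(1)] by (simp add: d_def)
    then have "cinner (s + \<pi> h \<zeta>) \<eta> = of_nat (Suc n) * d"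
      using s(2) by (simp add: cinner_add_left algebra_simps)
    moreover have "cinner (s + \<pi> h \<zeta>) (\<pi> h' \<zeta>) = 0"
      if h': "h' \<in> Stab B" "free_over L M B (D \<union> h ` ?X) (h' ` ?X)" for h'
    proof -
      have "free_over L M B D (h' ` ?X)" "free_over L M B (h ` ?X) (h' ` ?X)"
        using free_over_mono[OF h'(2)] D(3) hX(3) by blast+
      then show ?thesis using perp[OF h'(1)] orth[OF h(1) h'(1)] by (simp add: cinner_add_left)
    qed
    ultimately show ?case
      using D hX by (intro exI[of _ "s + \<pi> h \<zeta>"] exI[of _ "D \<union> h ` ?X"]) auto
  qed
  have bound: "real n * (cmod d)\<^sup>2 \<le> (norm \<zeta>)\<^sup>2 * (norm \<eta>)\<^sup>2" for n
  proof (cases "n = 0")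
    case False
    obtain s where s: "(norm s)\<^sup>2 = real n * (norm \<zeta>)\<^sup>2" "cinner s \<eta> = of_nat n * d"
      using sums[of n] by blast
    have "real n * cmod d \<le> norm s * norm \<eta>"
      using Cauchy_Schwarz_cinner[of s \<eta>] s(2) by (simp add: norm_mult)
    then have "(real n * cmod d)\<^sup>2 \<le> (norm s * norm \<eta>)\<^sup>2" by (intro power_mono) auto
    moreover have "(norm s * norm \<eta>)\<^sup>2 = real n * ((norm \<zeta>)\<^sup>2 * (norm \<eta>)\<^sup>2)"
      by (simp only: power_mult_distrib s(1) mult.assoc)
    moreover have "(real n * cmod d)\<^sup>2 = real n * (real n * (cmod d)\<^sup>2)"
      by (simp add: power2_eq_square)
    ultimately show ?thesis using False by simp
  qed simp
  have "d = 0"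
  proof (rule ccontr)
    assume "d \<noteq> 0"
    then obtain n where "(norm \<zeta>)\<^sup>2 * (norm \<eta>)\<^sup>2 < real n * (cmod d)\<^sup>2"
      using reals_Archimedean3[of "(cmod d)\<^sup>2"] by auto
    then show False using bound[of n] by simp
  qed
  then show ?thesis by (simp add: d_def \<zeta>_def)
qed

lemma rep_dissociated: "dissociated_rep (universe M) (Aut L M) \<pi>"
  unfolding dissociated_rep_def
proof (intro allI impI ext)
  fix A B x
  assume AB: "finite A \<and> A \<subseteq> universe M \<and> finite B \<and> B \<subseteq> universe M"
  obtain y where y: "y \<in> Fix B" "\<And>w. w \<in> Fix B \<Longrightarrow> cinner (x - y) w = 0"
    using orthogonal_decomposition_exists[OF fix_closed_csubspace] by blast
  obtain z where z: "z \<in> Fix (A \<inter> B)" "\<And>w. w \<in> Fix (A \<inter> B) \<Longrightarrow> cinner (y - z) w = 0"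
    using orthogonal_decomposition_exists[OF fix_closed_csubspace] by blast
  have "orth_proj (Fix B) x = y" by (rule orth_proj_eqI[OF fix_closed_csubspace y])
  moreover have "orth_proj (Fix A) y = z"
  proof (rule orth_proj_eqI[OF fix_closed_csubspace])
    show "z \<in> Fix A" using z(1) fix_mono[of "A \<inter> B" A] by blast
    show "cinner (y - z) w = 0" if "w \<in> Fix A" for w
      using fix_orthogonal[of B A y w z] AB y(1) that z by (simp add: Int_commute)
  qed
  moreover have "orth_proj (Fix (A \<inter> B)) x = z"
  proof (rule orth_proj_eqI[OF fix_closed_csubspace z(1)])
    fix w assume w: "w \<in> Fix (A \<inter> B)"
    then have "cinner (x - y) w = 0" using y(2) fix_mono[of "A \<inter> B" B] by blast
    then show "cinner (x - z) w = 0" using z(2)[OF w] by (simp add: cinner_diff_left)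
  qed
  ultimately show "(orth_proj (Fix A) \<circ> orth_proj (Fix B)) x = orth_proj (Fix (A \<inter> B)) x"
    by simp
qed

end

theorem theorem5p31:
  fixes L :: "'r language" and M :: "('a, 'r) rel_structure"
  assumes "fraisse_limit L M"
    and "free_amalgamation L M"
  shows "dissociated TYPE('h::complex_hilbert_space) (universe M) (Aut L M)"
  unfolding dissociated_def
proof (intro allI impI)
  fix \<pi> :: "('a \<Rightarrow> 'a) \<Rightarrow> 'h \<Rightarrow> 'h"
  assume "unitary_rep (Aut L M) \<pi>"
  then interpret free_fraisse_rep L M \<pi>
    using assms by unfold_locales
  show "dissociated_rep (universe M) (Aut L M) \<pi>"
    by (rule rep_dissociated)
qed

end
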